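(* There exists a function $f\colon[-1,1]\to\mathbb{R}$ that is Riemann integrable on $[-1,1]$, has an antiderivative on $[-1,1]$ (i.e. there is a differentiable $F\colon[-1,1]\to\mathbb{R}$ with $F'(x)=f(x)$ for all $x\in[-1,1]$), and satisfies both of the following conditions: (1) $f$ has no local extrema on $[-1,1]$, i.e. no point $x_0\in[-1,1]$ is a point of local maximum or local minimum of $f$; (2) $f$ is not monotone on any interval $(a,b)\subset[-1,1]$ with $a<b$.
   Context: Neighbourhoods of a point $x$ are the sets $(x-\varepsilon,x+\varepsilon)$, $\varepsilon>0$, intersected with the domain of the function. A point $x_0$ is a local maximum (minimum) of $f$ if $f(x)\le f(x_0)$ (resp. $f(x)\ge f(x_0)$) for all $x$ in some neighbourhood of $x_0$; in particular, the endpoints $\pm1$ are also considered (with one-sided neighbourhoods). Monotone means non-decreasing or non-increasing. At the endpoints of $[-1,1]$ derivatives are one-sided. *)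

theory Defs
  imports "HOL-Analysis.Analysis"
begin

text \<open>
  The library's \<^const>\<open>integrable_on\<close> is Henstock--Kurzweil integrability, which every derivative
  satisfies, so Riemann integrability needs its own definition: convergence of the Riemann sums over
  tagged partitions as the mesh tends to 0. Here \<open>measure lborel K\<close> is the length of the
  interval; a \<open>tagged_division_of\<close> may contain degenerate one-point intervals, which contribute 0.
\<close>

definition has_riemann_integral :: "(real \<Rightarrow> real) \<Rightarrow> real \<Rightarrow> real \<Rightarrow> real \<Rightarrow> bool" where
  "has_riemann_integral f I a b \<longleftrightarrow>
     (\<forall>e>0. \<exists>d>0. \<forall>p. p tagged_division_of {a..b} \<and> (\<forall>(x, K)\<in>p. measure lborel K < d) \<longrightarrow>
        \<bar>(\<Sum>(x, K)\<in>p. measure lborel K * f x) - I\<bar> < e)"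

definition riemann_integrable :: "(real \<Rightarrow> real) \<Rightarrow> real \<Rightarrow> real \<Rightarrow> bool" where
  "riemann_integrable f a b \<longleftrightarrow> (\<exists>I. has_riemann_integral f I a b)"

definition has_antiderivative_on :: "(real \<Rightarrow> real) \<Rightarrow> real set \<Rightarrow> bool" where
  "has_antiderivative_on f S \<longleftrightarrow>
     (\<exists>F. \<forall>x\<in>S. (F has_real_derivative f x) (at x within S))"

text \<open>Local extrema are relative to the domain \<open>S\<close> and need not be strict.\<close>

definition local_max_on :: "real set \<Rightarrow> (real \<Rightarrow> real) \<Rightarrow> real \<Rightarrow> bool" where
  "local_max_on S f x0 \<longleftrightarrow>
     x0 \<in> S \<and> (\<exists>\<epsilon>>0. \<forall>x \<in> {x0 - \<epsilon><..<x0 + \<epsilon>} \<inter> S. f x \<le> f x0)"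

definition local_min_on :: "real set \<Rightarrow> (real \<Rightarrow> real) \<Rightarrow> real \<Rightarrow> bool" where
  "local_min_on S f x0 \<longleftrightarrow>
     x0 \<in> S \<and> (\<exists>\<epsilon>>0. \<forall>x \<in> {x0 - \<epsilon><..<x0 + \<epsilon>} \<inter> S. f x \<ge> f x0)"

end

(*
  It suffices that f attains neither a maximum nor a minimum on any interval with rational endpoints.
  Such an f is the uniform limit of functions f_n, where step n deals with the n-th rational interval I
  and then fixes a tolerance function T_n > 0, so that every function within T_n of f_n still has no
  extremum on I; later steps stay within T_n. If the current function f attains its maximum on I at s,
  then f is continuous at s, and a spike c u(x) sin(1 / (x - s)) with a tent function u of peak 1 at s is
  added: the new supremum f(s) + c is approached near s but not attained. The spikes are derivatives up
  to a continuous function and are continuous except at one point, and both the existence of an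
  antiderivative and Riemann integrability survive uniform limits.
*)
theory Submission
  imports Defs
begin

section \<open>Riemann integrability\<close>

lemma continuous_has_riemann_integral:
  fixes g :: "real \<Rightarrow> real"
  assumes g: "continuous_on {a..b} g"
  shows "has_riemann_integral g (integral {a..b} g) a b"
  unfolding has_riemann_integral_def
proof (intro allI impI)
  fix e :: real assume e: "0 < e"
  define c where "c = measure lborel {a..b}"
  have c: "0 \<le> c" by (simp add: c_def)
  \<comment> \<open>The \<open>+ 1\<close> keeps the denominator positive when the interval is
    degenerate or empty.\<close>
  define e' where "e' = e / (c + 1)"
  have e': "0 < e'" and e'c: "e' * c < e"
    using e c by (auto simp: e'_def field_simps)
  have "uniformly_continuous_on {a..b} g"
    using g by (simp add: compact_uniformly_continuous)
  then obtain d where d: "0 < d"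
    "\<And>x y. x \<in> {a..b} \<Longrightarrow> y \<in> {a..b} \<Longrightarrow> dist y x < d \<Longrightarrow> dist (g y) (g x) < e'"
    using e' unfolding uniformly_continuous_on_def by metis
  show "\<exists>d>0. \<forall>p. p tagged_division_of {a..b} \<and> (\<forall>(x, K)\<in>p. measure lborel K < d) \<longrightarrow>
        \<bar>(\<Sum>(x, K)\<in>p. measure lborel K * g x) - integral {a..b} g\<bar> < e"
  proof (intro exI[of _ d] conjI allI impI \<open>0 < d\<close>)
    fix p assume p: "p tagged_division_of {a..b} \<and> (\<forall>(x, K)\<in>p. measure lborel K < d)"
    then have tp: "p tagged_division_of cbox a b" by simp
    have gint: "g integrable_on cbox a b" using g integrable_continuous_real by auto
    have piece: "\<bar>measure lborel K * g x - integral K g\<bar> \<le> measure lborel K * e'" if xK: "(x, K) \<in> p" for x K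
    proof -
      obtain u v where K: "K = {u..v}" and x: "x \<in> K" and sub: "K \<subseteq> {a..b}"
        using tagged_division_ofD(2-4)[OF tp xK] by auto
      have uv: "u \<le> v" using x K by auto
      have mesh: "v - u < d" using p xK K uv by fastforce
      have gK: "g integrable_on {u..v}"
        using gint sub K integrable_on_subinterval by fastforce
      have "norm (integral (cbox u v) (\<lambda>y. g x - g y)) \<le> e' * measure lborel (cbox u v)"
      proof (rule integrable_bound)
        show "0 \<le> e'" using e' by simp
        show "(\<lambda>y. g x - g y) integrable_on cbox u v" using gK by (intro integrable_diff) auto
        show "norm (g x - g y) \<le> e'" if "y \<in> cbox u v" for y
        proof -
          have "dist y x < d" using that x K mesh by (auto simp: dist_real_def)
          then have "dist (g y) (g x) < e'" using d(2)[of x y] x K sub that by auto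
          then show ?thesis by (simp add: dist_real_def)
        qed
      qed
      moreover have "integral {u..v} (\<lambda>y. g x - g y) = measure lborel K * g x - integral K g"
        using gK uv by (simp add: K integral_diff integrable_const_ivl)
      ultimately show ?thesis by (simp add: K mult.commute)
    qed
    have fin: "finite p" using tp by blast
    have "(\<Sum>(x, K)\<in>p. measure lborel K * g x) - integral {a..b} g
        = (\<Sum>(x, K)\<in>p. measure lborel K * g x - integral K g)"
      using integral_combine_tagged_division_topdown[OF gint tp]
      by (simp add: sum_subtractf case_prod_unfold)
    also have "\<bar>\<dots>\<bar> \<le> (\<Sum>(x, K)\<in>p. measure lborel K * e')"
      by (rule order_trans[OF sum_abs]) (auto intro!: sum_mono dest: piece)
    also have "\<dots> = c * e'"
      using additive_content_tagged_division[OF tp]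
      by (simp add: c_def sum_distrib_right[symmetric] case_prod_unfold)
    also have "\<dots> < e" using e'c by (simp add: mult.commute)
    finally show "\<bar>(\<Sum>(x, K)\<in>p. measure lborel K * g x) - integral {a..b} g\<bar> < e" .
  qed
qed

text \<open>Darboux's criterion with continuous functions in place of step functions:
  \<open>f\<close> lies between \<open>g - w\<close> and \<open>g + w\<close>, whose integrals
  differ by less than \<open>2 * e\<close>. In this form it passes easily to sums and uniform
  limits.\<close>

definition squeezed :: "real \<Rightarrow> real \<Rightarrow> (real \<Rightarrow> real) \<Rightarrow> bool" where
  "squeezed a b f \<longleftrightarrow>
     (\<forall>e>0. \<exists>g w. continuous_on {a..b} g \<and> continuous_on {a..b} w \<and>
        (\<forall>x\<in>{a..b}. \<bar>f x - g x\<bar> \<le> w x) \<and> integral {a..b} w < e)"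

text \<open>A Riemann sum of \<open>f\<close> differs from that of \<open>g\<close> by at most the
  Riemann sum of \<open>w\<close>, and for a fine mesh the sums of \<open>g\<close> and
  \<open>w\<close> are close to their integrals. The Henstock-Kurzweil integral of \<open>f\<close>
  is the candidate for the limit.\<close>

lemma squeezed_imp_riemann_integrable:
  assumes f: "squeezed a b f" and int: "f integrable_on {a..b}"
  shows "riemann_integrable f a b"
  unfolding riemann_integrable_def
proof
  show "has_riemann_integral f (integral {a..b} f) a b"
    unfolding has_riemann_integral_def
  proof (intro allI impI)
    fix e :: real assume "0 < e"
    then have e: "0 < e / 5" by simp
    then obtain g w where g: "continuous_on {a..b} g" and w: "continuous_on {a..b} w"
      and fg: "\<And>x. x \<in> {a..b} \<Longrightarrow> \<bar>f x - g x\<bar> \<le> w x" and we: "integral {a..b} w < e / 5"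
      using f unfolding squeezed_def by meson
    obtain d1 where d1: "0 < d1"
      "\<And>p. p tagged_division_of {a..b} \<Longrightarrow> (\<forall>(x, K)\<in>p. measure lborel K < d1) \<Longrightarrow>
        \<bar>(\<Sum>(x, K)\<in>p. measure lborel K * g x) - integral {a..b} g\<bar> < e / 5"
      using continuous_has_riemann_integral[OF g] e unfolding has_riemann_integral_def by meson
    obtain d2 where d2: "0 < d2"
      "\<And>p. p tagged_division_of {a..b} \<Longrightarrow> (\<forall>(x, K)\<in>p. measure lborel K < d2) \<Longrightarrow>
        \<bar>(\<Sum>(x, K)\<in>p. measure lborel K * w x) - integral {a..b} w\<bar> < e / 5"
      using continuous_has_riemann_integral[OF w] e unfolding has_riemann_integral_def by meson
    have "norm (integral {a..b} (\<lambda>x. f x - g x)) \<le> integral {a..b} w"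
      using fg g w
      by (intro integral_norm_bound_integral integrable_diff[OF int]) (auto intro: integrable_continuous_real)
    then have near: "\<bar>integral {a..b} f - integral {a..b} g\<bar> \<le> integral {a..b} w"
      by (simp add: integral_diff int integrable_continuous_real g)
    show "\<exists>d>0. \<forall>p. p tagged_division_of {a..b} \<and> (\<forall>(x, K)\<in>p. measure lborel K < d) \<longrightarrow>
          \<bar>(\<Sum>(x, K)\<in>p. measure lborel K * f x) - integral {a..b} f\<bar> < e"
    proof (intro exI[of _ "min d1 d2"] conjI allI impI)
      fix p assume p: "p tagged_division_of {a..b} \<and> (\<forall>(x, K)\<in>p. measure lborel K < min d1 d2)"
      have 1: "\<bar>(\<Sum>(x, K)\<in>p. measure lborel K * g x) - integral {a..b} g\<bar> < e / 5"
        using p by (intro d1(2)) auto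
      have 2: "\<bar>(\<Sum>(x, K)\<in>p. measure lborel K * w x) - integral {a..b} w\<bar> < e / 5"
        using p by (intro d2(2)) auto
      have "\<bar>(\<Sum>(x, K)\<in>p. measure lborel K * f x) - (\<Sum>(x, K)\<in>p. measure lborel K * g x)\<bar>
          = \<bar>\<Sum>(x, K)\<in>p. measure lborel K * (f x - g x)\<bar>"
        by (simp add: sum_subtractf[symmetric] case_prod_unfold right_diff_distrib)
      also have "\<dots> \<le> (\<Sum>(x, K)\<in>p. measure lborel K * w x)"
      proof (rule order_trans[OF sum_abs sum_mono])
        fix z assume z: "z \<in> p"
        obtain x K where [simp]: "z = (x, K)" by force
        have "x \<in> {a..b}"
          using tagged_division_ofD(2,3)[of p "{a..b}" x K] p z by auto
        then show "\<bar>case z of (x, K) \<Rightarrow> measure lborel K * (f x - g x)\<bar>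
            \<le> (case z of (x, K) \<Rightarrow> measure lborel K * w x)"
          using fg by (simp add: abs_mult mult_left_mono)
      qed
      \<comment> \<open>The sum of \<open>w\<close> is below \<open>2 * e / 5\<close>, the sum of
        \<open>g\<close> is within \<open>e / 5\<close> of its integral, and the integrals of
        \<open>f\<close> and \<open>g\<close> differ by less than \<open>e / 5\<close>: in all less
        than \<open>4 * e / 5\<close>.\<close>
      finally show "\<bar>(\<Sum>(x, K)\<in>p. measure lborel K * f x) - integral {a..b} f\<bar> < e"
        using 1 2 near we by linarith
    qed (use d1 d2 in auto)
  qed
qed

lemma squeezed_0: "squeezed a b (\<lambda>x. 0)"
  unfolding squeezed_def by (intro allI impI exI[of _ "\<lambda>x. 0"]) auto

lemma squeezed_add:
  assumes "squeezed a b f" "squeezed a b g"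
  shows "squeezed a b (\<lambda>x. f x + g x)"
  unfolding squeezed_def
proof (intro allI impI)
  fix e :: real assume "0 < e"
  then have e: "0 < e / 2" by simp
  obtain f1 w1 where 1: "continuous_on {a..b} f1" "continuous_on {a..b} w1"
    "\<And>x. x \<in> {a..b} \<Longrightarrow> \<bar>f x - f1 x\<bar> \<le> w1 x" "integral {a..b} w1 < e / 2"
    using assms(1) e unfolding squeezed_def by meson
  obtain f2 w2 where 2: "continuous_on {a..b} f2" "continuous_on {a..b} w2"
    "\<And>x. x \<in> {a..b} \<Longrightarrow> \<bar>g x - f2 x\<bar> \<le> w2 x" "integral {a..b} w2 < e / 2"
    using assms(2) e unfolding squeezed_def by meson
  have "integral {a..b} (\<lambda>x. w1 x + w2 x) < e"
    using 1 2 by (simp add: integral_add integrable_continuous_real)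
  moreover have "\<bar>f x + g x - (f1 x + f2 x)\<bar> \<le> w1 x + w2 x" if "x \<in> {a..b}" for x
    using 1(3)[OF that] 2(3)[OF that] by linarith
  ultimately show "\<exists>h w. continuous_on {a..b} h \<and> continuous_on {a..b} w \<and>
      (\<forall>x\<in>{a..b}. \<bar>f x + g x - h x\<bar> \<le> w x) \<and> integral {a..b} w < e"
    using 1(1,2) 2(1,2)
    by (intro exI[of _ "\<lambda>x. f1 x + f2 x"] exI[of _ "\<lambda>x. w1 x + w2 x"]) (auto intro: continuous_on_add)
qed

lemma squeezed_uminus:
  assumes "squeezed a b f"
  shows "squeezed a b (\<lambda>x. - f x)"
  unfolding squeezed_def
proof (intro allI impI)
  fix e :: real assume "0 < e"
  then obtain g w where g: "continuous_on {a..b} g" "continuous_on {a..b} w"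
    "\<And>x. x \<in> {a..b} \<Longrightarrow> \<bar>f x - g x\<bar> \<le> w x" "integral {a..b} w < e"
    using assms unfolding squeezed_def by meson
  have "\<bar>- f x - - g x\<bar> \<le> w x" if "x \<in> {a..b}" for x
    using g(3)[OF that] by linarith
  with g show "\<exists>g w. continuous_on {a..b} g \<and> continuous_on {a..b} w \<and>
      (\<forall>x\<in>{a..b}. \<bar>- f x - g x\<bar> \<le> w x) \<and> integral {a..b} w < e"
    by (intro exI[of _ "\<lambda>x. - g x"] exI[of _ w]) (auto intro: continuous_on_minus)
qed

text \<open>Adding a constant \<open>e'\<close> to \<open>w\<close> absorbs the approximation error
  and costs only \<open>e'\<close> times the length of the interval.\<close>

lemma squeezed_uniform_approx:
  assumes approx: "\<And>e. 0 < e \<Longrightarrow> \<exists>g. squeezed a b g \<and> (\<forall>x\<in>{a..b}. \<bar>f x - g x\<bar> \<le> e)"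
  shows "squeezed a b f"
  unfolding squeezed_def
proof (intro allI impI)
  fix e :: real assume e: "0 < e"
  define c where "c = measure lborel {a..b}"
  have c: "0 \<le> c" by (simp add: c_def)
  define e' where "e' = e / 2 / (c + 1)"
  have e': "0 < e'" and e'c: "e' * c < e / 2"
    using e c by (auto simp: e'_def field_simps)
  obtain k where k: "squeezed a b k" "\<And>x. x \<in> {a..b} \<Longrightarrow> \<bar>f x - k x\<bar> \<le> e'"
    using approx[OF e'] by auto
  obtain g w where g: "continuous_on {a..b} g" "continuous_on {a..b} w"
    "\<And>x. x \<in> {a..b} \<Longrightarrow> \<bar>k x - g x\<bar> \<le> w x" "integral {a..b} w < e / 2"
    using k(1) e unfolding squeezed_def by (metis half_gt_zero)
  have "integral {a..b} (\<lambda>x. w x + e') = integral {a..b} w + c * e'"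
    using g by (simp add: integral_add integrable_continuous_real c_def measure_def)
  then have "integral {a..b} (\<lambda>x. w x + e') < e"
    using g e'c by (simp add: mult.commute)
  moreover have "\<bar>f x - g x\<bar> \<le> w x + e'" if "x \<in> {a..b}" for x
    using g(3)[OF that] k(2)[OF that] by linarith
  ultimately show "\<exists>g w. continuous_on {a..b} g \<and> continuous_on {a..b} w \<and>
      (\<forall>x\<in>{a..b}. \<bar>f x - g x\<bar> \<le> w x) \<and> integral {a..b} w < e"
    using g(1,2)
    by (intro exI[of _ g] exI[of _ "\<lambda>x. w x + e'"]) (auto intro!: continuous_intros)
qed

section \<open>Oscillating spikes\<close>

text \<open>For positive \<open>c\<close> and \<open>d\<close>, a tent of height \<open>c\<close>
  and half-width \<open>d\<close> filled with oscillation. Since \<open>1 / 0 = 0\<close>, the value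
  at \<open>s\<close> is \<open>0\<close>.\<close>

definition spike :: "real \<Rightarrow> real \<Rightarrow> real \<Rightarrow> real \<Rightarrow> real" where
  "spike c d s x = c * max 0 (1 - \<bar>x - s\<bar> / d) * sin (1 / (x - s))"

text \<open>A factor that vanishes at \<open>s\<close> removes the discontinuity of a bounded factor
  there; the bounded factor will be the sine or cosine of \<open>1 / (x - s)\<close>.\<close>

lemma isCont_times_bounded:
  fixes q b :: "real \<Rightarrow> real"
  assumes q: "isCont q x" "q s = 0" and b: "\<And>x. \<bar>b x\<bar> \<le> 1" "x \<noteq> s \<Longrightarrow> isCont b x"
  shows "isCont (\<lambda>x. q x * b x) x"
proof (cases "x = s")
  case True
  have "(q \<longlongrightarrow> 0) (at s)" using q True by (simp add: isCont_def)
  then have "((\<lambda>x. q x * b x) \<longlongrightarrow> 0) (at s)"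
    by (rule Lim_null_comparison[rotated, OF tendsto_rabs_zero])
      (auto intro!: always_eventually simp: abs_mult intro: mult_left_le b(1))
  then show ?thesis using q True by (simp add: isCont_def)
qed (use q b in auto)

lemma spike_self [simp]: "spike c d s s = 0"
  by (simp add: spike_def)

lemma abs_spike_le:
  assumes "0 < c" "0 < d"
  shows "\<bar>spike c d s x\<bar> \<le> c * max 0 (1 - \<bar>x - s\<bar> / d)"
  using assms by (auto simp: spike_def abs_mult intro!: mult_left_le)

text \<open>Strict, because the tent has height \<open>c\<close> only at \<open>s\<close>, where the
  sine is \<open>0\<close>. Hence \<open>c - \<bar>spike c d s x\<bar>\<close> can serve as a
  positive tolerance.\<close>

lemma abs_spike_less:
  assumes "0 < c" "0 < d"
  shows "\<bar>spike c d s x\<bar> < c"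
proof (cases "x = s")
  case False
  then have "max 0 (1 - \<bar>x - s\<bar> / d) < 1" using assms by auto
  then have "c * max 0 (1 - \<bar>x - s\<bar> / d) < c * 1"
    using assms by (intro mult_strict_left_mono) auto
  then show ?thesis using abs_spike_le[OF assms, of s x] by linarith
qed (use assms in auto)

lemma spike_eq_0:
  assumes "0 < d" "d \<le> \<bar>x - s\<bar>"
  shows "spike c d s x = 0"
proof -
  have "1 \<le> \<bar>x - s\<bar> / d" using assms by (simp add: field_simps)
  then show ?thesis by (simp add: spike_def max_def)
qed

lemma isCont_spike:
  assumes "x \<noteq> s" "0 < d"
  shows "isCont (spike c d s) x"
  unfolding spike_def[abs_def] using assms by (intro continuous_intros) auto

text \<open>The derivative of \<open>H\<close> is the pure oscillation
  \<open>sin (1 / (x - s))\<close> plus a term that tends to \<open>0\<close> at \<open>s\<close>.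
  Subtracting \<open>c\<close> times this derivative from the spike leaves \<open>\<phi>\<close>,
  whose sine and cosine have coefficients vanishing at \<open>s\<close>, so that
  \<open>\<phi>\<close> is continuous.\<close>

lemma spike_has_antiderivative:
  assumes d: "0 < d"
  shows "\<exists>F. \<forall>x. (F has_real_derivative spike c d s x) (at x)"
proof -
  define \<phi> where "\<phi> x = (c * (max 0 (1 - \<bar>x - s\<bar> / d) - 1)) * sin (1 / (x - s))
      + (- 2 * c * (x - s)) * cos (1 / (x - s))" for x
  have "isCont \<phi> x" for x
    unfolding \<phi>_def using d
    by (intro isCont_add isCont_times_bounded[where s = s and b = "\<lambda>x. sin (1 / (x - s))"]
        isCont_times_bounded[where s = s and b = "\<lambda>x. cos (1 / (x - s))"])
      (auto intro!: continuous_intros)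
  then have "\<exists>G. \<forall>x::real. -\<infinity> < ereal x \<longrightarrow> ereal x < \<infinity> \<longrightarrow> (G has_vector_derivative \<phi> x) (at x)"
    by (intro einterval_antiderivative) auto
  then obtain G where G: "\<And>x. (G has_real_derivative \<phi> x) (at x)"
    by (auto simp: has_real_derivative_iff_has_vector_derivative)
  define H where "H x = (x - s)^2 * cos (1 / (x - s))" for x
  have H: "(H has_real_derivative (2 * (x - s) * cos (1 / (x - s)) + sin (1 / (x - s)))) (at x)" for x
  proof (cases "x = s")
    case True
    have "isCont (\<lambda>x. (x - s) * cos (1 / (x - s))) s"
      by (intro isCont_times_bounded[where s = s and b = "\<lambda>x. cos (1 / (x - s))"])
        (auto intro!: continuous_intros)
    then have "((\<lambda>x. (x - s) * cos (1 / (x - s))) \<longlongrightarrow> 0) (at s)"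
      by (simp add: isCont_def)
    then have "((\<lambda>x. (H x - H s) / (x - s)) \<longlongrightarrow> 0) (at s)"
      by (rule Lim_transform_eventually)
        (auto simp: eventually_at_filter H_def power2_eq_square)
    then show ?thesis using True by (simp add: has_field_derivative_iff)
  next
    case False
    then show ?thesis unfolding H_def
      by (auto intro!: derivative_eq_intros simp: power2_eq_square)
  qed
  have "((\<lambda>x. G x + c * H x) has_real_derivative spike c d s x) (at x)" for x
    by (rule DERIV_cong[OF DERIV_add[OF G DERIV_cmult[OF H]]])
      (simp add: \<phi>_def spike_def algebra_simps)
  then show ?thesis by blast
qed

text \<open>Damping the spike by a factor that vanishes at \<open>s\<close> and is close to
  \<open>1\<close> away from it makes it continuous. The error is dominated by a bump whose integral
  is an explicit arctangent.\<close>

lemma squeezed_spike: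
  assumes c: "0 < c" and d: "0 < d"
  shows "squeezed a b (spike c d s)"
  unfolding squeezed_def
proof (intro allI impI)
  fix e :: real assume e: "0 < e"
  \<comment> \<open>Chosen so that \<open>4 * c * r = e\<close>; the arctangent rises by less than
    \<open>pi < 4\<close>.\<close>
  define r where "r = e / (4 * c)"
  have r: "0 < r" using e c by (simp add: r_def)
  have r2: "0 < r\<^sup>2 + (x - s)\<^sup>2" for x using r by (simp add: add_pos_nonneg)
  define g where "g x = (c * max 0 (1 - \<bar>x - s\<bar> / d) * ((x - s)\<^sup>2 / (r\<^sup>2 + (x - s)\<^sup>2))) * sin (1 / (x - s))" for x
  define w where "w x = c * (r\<^sup>2 / (r\<^sup>2 + (x - s)\<^sup>2))" for x
  have "isCont g x" for x
    unfolding g_def using d r2[of x]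
    by (intro isCont_times_bounded[where s = s and b = "\<lambda>x. sin (1 / (x - s))"])
      (auto intro!: continuous_intros)
  then have g: "continuous_on {a..b} g"
    by (simp add: continuous_at_imp_continuous_on)
  have w: "continuous_on {a..b} w"
    unfolding w_def using r2 by (auto intro!: continuous_intros simp: less_imp_neq[symmetric])
  have le: "\<bar>spike c d s x - g x\<bar> \<le> w x" for x
  proof -
    have q: "1 - (x - s)\<^sup>2 / (r\<^sup>2 + (x - s)\<^sup>2) = r\<^sup>2 / (r\<^sup>2 + (x - s)\<^sup>2)"
      using r by (simp add: diff_eq_eq add_divide_distrib[symmetric])
    have "spike c d s x - g x = spike c d s x * (1 - (x - s)\<^sup>2 / (r\<^sup>2 + (x - s)\<^sup>2))"
      by (simp add: spike_def g_def algebra_simps)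
    then have "\<bar>spike c d s x - g x\<bar> = \<bar>spike c d s x\<bar> * (r\<^sup>2 / (r\<^sup>2 + (x - s)\<^sup>2))"
      using r2[of x] by (simp add: q abs_mult)
    also have "\<dots> \<le> w x"
      unfolding w_def using abs_spike_less[OF c d, of s x] r2[of x] by (intro mult_right_mono) auto
    finally show ?thesis .
  qed
  have "integral {a..b} w < e"
  proof (cases "a \<le> b")
    case True
    have der: "((\<lambda>x. c * r * arctan ((x - s) / r)) has_real_derivative w x) (at x within {a..b})" for x
      unfolding w_def using r r2[of x]
      by (auto intro!: derivative_eq_intros simp: divide_simps power2_eq_square)
    have "(w has_integral (c * r * arctan ((b - s) / r) - c * r * arctan ((a - s) / r))) {a..b}"
      using True der
      by (intro fundamental_theorem_of_calculus)
        (auto simp: has_real_derivative_iff_has_vector_derivative[symmetric])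
    then have "integral {a..b} w = c * r * (arctan ((b - s) / r) - arctan ((a - s) / r))"
      by (simp add: integral_unique algebra_simps)
    also have "\<dots> < c * r * 4"
    proof (rule mult_strict_left_mono)
      show "arctan ((b - s) / r) - arctan ((a - s) / r) < 4"
        using arctan_ubound[of "(b - s) / r"] arctan_lbound[of "(a - s) / r"] pi_less_4 by linarith
    qed (use c r in auto)
    also have "\<dots> = e" using c by (simp add: r_def)
    finally show ?thesis .
  qed (use e in auto)
  then show "\<exists>g w. continuous_on {a..b} g \<and> continuous_on {a..b} w \<and>
      (\<forall>x\<in>{a..b}. \<bar>spike c d s x - g x\<bar> \<le> w x) \<and> integral {a..b} w < e"
    using g w le by blast
qed

lemma sin_inverse_attains:
  fixes \<sigma> \<tau> e :: real
  assumes "\<sigma> \<in> {-1, 1}" "\<tau> \<in> {-1, 1}" "0 < e"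
  shows "\<exists>t. 0 < \<tau> * t \<and> \<tau> * t < e \<and> sin (1 / t) = \<sigma>"
proof -
  obtain k :: nat where k: "1 / e < real k" using reals_Archimedean2 by blast
  \<comment> \<open>For \<open>t = \<tau> / m\<close> oddness gives
    \<open>sin (1 / t) = \<tau> * sin m\<close>, so \<open>sin m\<close> must be
    \<open>\<sigma> * \<tau>\<close>. The extra turn in \<open>real k + 1\<close> keeps
    \<open>m\<close> above \<open>2 * pi * real k\<close> when the quarter turn is negative.\<close>
  define m where "m = 2 * pi * (real k + 1) + \<sigma> * \<tau> * (pi / 2)"
  have st: "-1 \<le> \<sigma> * \<tau>" using assms by auto
  have "\<sigma> * \<tau> * (pi / 2) \<ge> -1 * (pi / 2)" by (rule mult_right_mono[OF st]) simp
  then have m1: "2 * pi * real k < m" unfolding m_def using pi_gt_zero by (simp only: distrib_left mult_1_right)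
  have "1 * real k \<le> 2 * pi * real k" using pi_gt3 by (intro mult_right_mono) auto
  then have m2: "1 / e < m" using k m1 by linarith
  have m: "0 < m" by (rule less_trans[OF _ m2]) (use assms in simp)
  have p: "sin (2 * pi * (real k + 1) + y) = sin y" for y
    using sin_2npi[of "k+1"] cos_2npi[of "k+1"] by (simp add: sin_add mult_ac add.commute)
  have "sin (\<tau> * m) = \<tau> * sin m" using assms by auto
  also have "sin m = \<sigma> * \<tau>" unfolding m_def p using assms by auto
  finally have "sin (\<tau> * m) = \<sigma>" using assms by auto
  moreover have "1 / (\<tau> / m) = \<tau> * m" using assms m by auto
  moreover have "\<tau> * (\<tau> / m) = 1 / m" using assms by auto
  moreover have "1 / m < e" using m2 m assms by (simp add: field_simps)
  ultimately show ?thesis using m by (intro exI[of _ "\<tau> / m"]) auto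
qed

text \<open>
  The hypothesis on \<open>h\<close> allows an error up to \<open>c / 2\<close> at \<open>s\<close> but none where the spike comes close
  to \<open>\<plusminus>c\<close>, so \<open>h\<close> inherits the oscillation of the spike.
\<close>

lemma spike_overshoot:
  fixes f h :: "real \<Rightarrow> real"
  assumes c: "0 < c" and d: "0 < d" and f: "isCont f s"
    and h: "\<And>x. \<bar>h x - (f x + spike c d s x)\<bar> \<le> (c - \<bar>spike c d s x\<bar>) / 2"
    and \<sigma>\<tau>: "\<sigma> \<in> {-1, 1}" "\<tau> \<in> {-1, 1}" and e: "0 < e" and \<delta>: "0 < \<delta>"
  shows "\<exists>y. 0 < \<tau> * (y - s) \<and> \<tau> * (y - s) < e \<and> \<sigma> * h y > \<sigma> * f s + c - \<delta>"
proof -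
  obtain r where r: "0 < r" "\<And>y. \<bar>y - s\<bar> < r \<Longrightarrow> \<bar>f y - f s\<bar> < \<delta> / 2"
    using f half_gt_zero[OF \<delta>] unfolding continuous_at_eps_delta dist_real_def by meson
  \<comment> \<open>The bounds serve, in order, the required distance, the continuity of
    \<open>f\<close>, staying under the tent, and a loss of tent height below
    \<open>\<delta> / 4\<close>.\<close>
  define e' where "e' = min e (min r (min d (d * \<delta> / (4 * c))))"
  have e': "0 < e'" using e r d \<delta> c by (auto simp: e'_def)
  obtain t where t: "0 < \<tau> * t" "\<tau> * t < e'" "sin (1 / t) = \<sigma>"
    using sin_inverse_attains[OF \<sigma>\<tau> e'] by blast
  have abst: "\<bar>t\<bar> = \<tau> * t" using t(1) \<sigma>\<tau> by auto
  define y where "y = s + t"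
  define p where "p = spike c d s y"
  have fy: "\<bar>f y - f s\<bar> < \<delta> / 2" using r(2)[of y] abst t(2) by (auto simp: y_def e'_def)
  have "\<bar>t\<bar> / d < 1" using abst t(2) d by (auto simp: e'_def)
  then have peq: "p = c * (1 - \<bar>t\<bar> / d) * \<sigma>" by (simp add: p_def spike_def y_def t(3))
  have "\<bar>t\<bar> < d * \<delta> / (4 * c)" using abst t(2) by (auto simp: e'_def)
  then have "c * (\<bar>t\<bar> / d) < \<delta> / 4" using c d by (simp add: field_simps)
  then have \<sigma>p: "\<sigma> * p > c - \<delta> / 4" unfolding peq using \<sigma>\<tau> by (auto simp: algebra_simps)
  have abs\<sigma>: "\<bar>\<sigma>\<bar> = 1" using \<sigma>\<tau>(1) by auto
  have "\<sigma> * p \<le> \<bar>p\<bar>" using \<sigma>\<tau> by auto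
  moreover have "\<bar>\<sigma> * (h y - (f y + p))\<bar> \<le> (c - \<bar>p\<bar>) / 2"
    using h[of y] by (simp add: abs_mult abs\<sigma> p_def)
  \<comment> \<open>The tolerance shrinks with the distance of the spike from its extreme value, so
    it is less than half of \<open>\<delta> / 4\<close>. The losses then add up to
    \<open>\<delta> / 4 + \<delta> / 8 + \<delta> / 2 < \<delta>\<close>.\<close>
  ultimately have "\<bar>\<sigma> * (h y - (f y + p))\<bar> < \<delta> / 8" using \<sigma>p by argo
  then have 1: "\<sigma> * h y > \<sigma> * f y + \<sigma> * p - \<delta> / 8"
    unfolding abs_less_iff right_diff_distrib distrib_left by linarith
  have "\<bar>\<sigma> * (f y - f s)\<bar> < \<delta> / 2" using fy by (simp add: abs_mult abs\<sigma>)
  then have 2: "\<sigma> * f y > \<sigma> * f s - \<delta> / 2" unfolding abs_less_iff right_diff_distrib distrib_left by linarith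
  have "\<sigma> * h y > \<sigma> * f s + c - \<delta>" using 1 2 \<sigma>p \<delta> by linarith
  then show ?thesis using t abst by (intro exI[of _ y]) (auto simp: y_def e'_def)
qed

section \<open>Refinement steps\<close>

text \<open>The sign \<open>\<sigma>\<close> selects larger or smaller values, \<open>\<tau>\<close>
  the right or left side. Both sides are demanded because \<open>x\<close> may be an endpoint of the
  interval under consideration.\<close>

definition oscillates :: "(real \<Rightarrow> real) \<Rightarrow> real \<Rightarrow> bool" where
  "oscillates h x \<longleftrightarrow>
     (\<forall>\<sigma>\<in>{-1, 1}. \<forall>\<tau>\<in>{-1, 1}. \<forall>e>0. \<exists>y. 0 < \<tau> * (y - x) \<and> \<tau> * (y - x) < e \<and> \<sigma> * h x < \<sigma> * h y)"

definition near :: "(real \<Rightarrow> real) \<Rightarrow> (real \<Rightarrow> real) \<Rightarrow> (real \<Rightarrow> real) \<Rightarrow> bool" where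
  "near f T h \<longleftrightarrow> (\<forall>x. \<bar>h x - f x\<bar> \<le> T x)"

text \<open>
  The tolerance \<open>T\<close> is positive, but it need not be bounded away from 0 near every point. Where it is
  not, or where \<open>f\<close> is discontinuous, the last conjunct says that the oscillation is already settled
  for every function within the tolerance.
\<close>

definition valid :: "(real \<Rightarrow> real) \<Rightarrow> (real \<Rightarrow> real) \<Rightarrow> bool" where
  "valid f T \<longleftrightarrow>
     (\<forall>x. 0 < T x) \<and>
     (\<exists>B. \<forall>x. \<bar>f x\<bar> \<le> B) \<and>
     (\<exists>F. \<forall>x. (F has_real_derivative f x) (at x)) \<and>
     squeezed (-1) 1 f \<and>
     (\<forall>x. (isCont f x \<and> (\<exists>\<eta>>0. \<forall>\<^sub>F y in nhds x. \<eta> \<le> T y)) \<or> (\<forall>h. near f T h \<longrightarrow> oscillates h x))"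

text \<open>The first part nests the tube of radius \<open>T'\<close> around \<open>f'\<close>
  inside that of radius \<open>T\<close> around \<open>f\<close>; the halving makes the tubes shrink
  to a single function.\<close>

definition refines :: "(real \<Rightarrow> real) \<Rightarrow> (real \<Rightarrow> real) \<Rightarrow> (real \<Rightarrow> real) \<Rightarrow> (real \<Rightarrow> real) \<Rightarrow> bool" where
  "refines f T f' T' \<longleftrightarrow> (\<forall>x. \<bar>f' x - f x\<bar> + T' x \<le> T x \<and> T' x \<le> T x / 2)"

definition attains_max :: "real \<Rightarrow> real \<Rightarrow> (real \<Rightarrow> real) \<Rightarrow> bool" where
  "attains_max a b h \<longleftrightarrow> (\<exists>x\<in>{a..b}. \<forall>y\<in>{a..b}. h y \<le> h x)"

lemma near_refines:
  assumes "refines f T f' T'" "near f' T' h"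
  shows "near f T h"
  unfolding near_def
proof
  fix x
  have "\<bar>f' x - f x\<bar> + T' x \<le> T x" "\<bar>h x - f' x\<bar> \<le> T' x"
    using assms by (auto simp: refines_def near_def)
  moreover have "\<bar>h x - f x\<bar> \<le> \<bar>h x - f' x\<bar> + \<bar>f' x - f x\<bar>"
    using abs_triangle_ineq[of "h x - f' x" "f' x - f x"] by simp
  ultimately show "\<bar>h x - f x\<bar> \<le> T x" by argo
qed

lemma near_uminus: "near (\<lambda>x. - f x) T h \<longleftrightarrow> near f T (\<lambda>x. - h x)"
  unfolding near_def by (simp add: abs_minus_commute add.commute)

lemma refines_trans:
  assumes "refines f T f1 T1" "refines f1 T1 f2 T2" "\<And>x. 0 < T x"
  shows "refines f T f2 T2"
  unfolding refines_def
proof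
  fix x
  have "\<bar>f1 x - f x\<bar> + T1 x \<le> T x \<and> T1 x \<le> T x / 2"
       "\<bar>f2 x - f1 x\<bar> + T2 x \<le> T1 x \<and> T2 x \<le> T1 x / 2"
    using assms(1,2) by (auto simp: refines_def)
  moreover have "\<bar>f2 x - f x\<bar> \<le> \<bar>f2 x - f1 x\<bar> + \<bar>f1 x - f x\<bar>"
    using abs_triangle_ineq[of "f2 x - f1 x" "f1 x - f x"] by simp
  ultimately show "\<bar>f2 x - f x\<bar> + T2 x \<le> T x \<and> T2 x \<le> T x / 2"
    using assms(3)[of x] by argo
qed

lemma oscillates_uminus: "oscillates (\<lambda>x. - h x) x \<longleftrightarrow> oscillates h x"
  unfolding oscillates_def by auto

lemma oscillates_not_max:
  assumes "oscillates h s" "s \<in> {a..b}" "a < b"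
  shows "\<exists>y\<in>{a..b}. h s < h y"
proof (cases "s < b")
  case True
  then obtain y where "0 < 1 * (y - s) \<and> 1 * (y - s) < b - s \<and> 1 * h s < 1 * h y"
    using assms(1) unfolding oscillates_def by (metis diff_gt_0_iff_gt insertCI)
  then show ?thesis using assms(2) by (intro bexI[of _ y]) auto
next
  case False
  then have "0 < s - a" using assms by auto
  then obtain y where "0 < (-1) * (y - s) \<and> (-1) * (y - s) < s - a \<and> 1 * h s < 1 * h y"
    using assms(1) unfolding oscillates_def by (metis insertCI)
  then show ?thesis using assms(2) by (intro bexI[of _ y]) auto
qed

text \<open>Lets minima be treated as maxima of the negated function.\<close>

lemma valid_uminus:
  assumes "valid f T"
  shows "valid (\<lambda>x. - f x) T"
proof -
  obtain F where F: "\<And>x. (F has_real_derivative f x) (at x)"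
    using assms unfolding valid_def by auto
  have "((\<lambda>x. - F x) has_real_derivative - f x) (at x)" for x
    using F by (rule DERIV_minus)
  then have "\<exists>F. \<forall>x. (F has_real_derivative - f x) (at x)" by blast
  moreover have "(isCont (\<lambda>x. - f x) x \<and> (\<exists>\<eta>>0. \<forall>\<^sub>F y in nhds x. \<eta> \<le> T y)) \<or>
      (\<forall>h. near (\<lambda>x. - f x) T h \<longrightarrow> oscillates h x)" for x
  proof -
    have "(isCont f x \<and> (\<exists>\<eta>>0. \<forall>\<^sub>F y in nhds x. \<eta> \<le> T y)) \<or>
        (\<forall>h. near f T h \<longrightarrow> oscillates h x)"
      using assms by (simp add: valid_def)
    moreover have "oscillates h x" if "\<forall>h. near f T h \<longrightarrow> oscillates h x" "near (\<lambda>x. - f x) T h" for h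
      using that oscillates_uminus[of h x] near_uminus[of f T h] by blast
    ultimately show ?thesis using continuous_minus[of "at x" f] by blast
  qed
  ultimately show ?thesis
    using assms squeezed_uminus unfolding valid_def by auto
qed

lemma eventually_ge_of_isCont:
  fixes g :: "real \<Rightarrow> real"
  assumes "isCont g x" "0 < g x"
  shows "\<exists>\<eta>>0. \<forall>\<^sub>F y in nhds x. \<eta> \<le> g y"
proof -
  have "(g \<longlongrightarrow> g x) (nhds x)" using assms(1) by (simp add: continuous_within tendsto_at_iff_tendsto_nhds)
  then have "\<forall>\<^sub>F y in nhds x. g x / 2 < g y" using assms(2) by (intro order_tendstoD) auto
  then show ?thesis using assms(2)
    by (intro exI[of _ "g x / 2"]) (auto elim: eventually_mono)
qed

text \<open>The spike raises the supremum on the interval to \<open>f s + c\<close>. Every function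
  within the new tolerance stays strictly below this value on the interval, yet comes arbitrarily
  close to it near \<open>s\<close>.\<close>

lemma refine_at_max:
  assumes v: "valid f T" and ab: "a < b" and s: "s \<in> {a..b}" "\<And>y. y \<in> {a..b} \<Longrightarrow> f y \<le> f s"
  shows "\<exists>f' T'. valid f' T' \<and> refines f T f' T' \<and> (\<forall>h. near f' T' h \<longrightarrow> \<not> attains_max a b h)"
proof -
  have Tpos: "\<And>x. 0 < T x" using v by (simp add: valid_def)
  have "near f T f" using Tpos by (simp add: near_def less_imp_le)
  \<comment> \<open>A settled point cannot be a maximum of \<open>f\<close>, so the first
    alternative of \<open>valid\<close> must hold at \<open>s\<close>.\<close>
  moreover have "\<not> oscillates f s" using oscillates_not_max[OF _ s(1) ab, of f] s(2) by force
  ultimately have cont: "isCont f s" and "\<exists>\<eta>>0. \<forall>\<^sub>F y in nhds s. \<eta> \<le> T y"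
    using v unfolding valid_def by blast+
  then obtain \<eta> d where \<eta>: "0 < \<eta>" and d: "0 < d" and Td: "\<And>y. \<bar>y - s\<bar> < d \<Longrightarrow> \<eta> \<le> T y"
    unfolding eventually_nhds_metric dist_real_def by meson
  \<comment> \<open>With this height the spike uses at most half of the old tolerance, leaving the
    other half for \<open>T'\<close>.\<close>
  define c where "c = \<eta> / 2"
  have c: "0 < c" using \<eta> by (simp add: c_def)
  define p where "p = spike c d s"
  have pc: "\<bar>p x\<bar> < c" for x unfolding p_def by (rule abs_spike_less[OF c d])
  have pT: "\<bar>p x\<bar> \<le> T x / 2" for x
  proof (cases "\<bar>x - s\<bar> < d")
    case True
    then show ?thesis using Td[OF True] pc[of x] by (simp add: c_def)
  next
    case False
    then show ?thesis using spike_eq_0[OF d, of x s c] Tpos[of x] by (simp add: p_def)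
  qed
  define f' where "f' x = f x + p x" for x
  define T' where "T' x = min (T x / 2) ((c - \<bar>p x\<bar>) / 2)" for x
  have ref: "refines f T f' T'"
    unfolding refines_def
  proof
    fix x show "\<bar>f' x - f x\<bar> + T' x \<le> T x \<and> T' x \<le> T x / 2"
      using pT[of x] by (auto simp: f'_def T'_def)
  qed
  have overshoot: "\<exists>y. 0 < \<tau> * (y - s) \<and> \<tau> * (y - s) < e \<and> \<sigma> * h y > \<sigma> * f s + c - \<delta>"
    if "near f' T' h" "\<sigma> \<in> {-1, 1}" "\<tau> \<in> {-1, 1}" "0 < e" "0 < \<delta>" for h \<sigma> \<tau> e \<delta>
    using that by (intro spike_overshoot[OF c d cont]) (auto simp: near_def f'_def T'_def p_def)
  have "valid f' T'"
    unfolding valid_def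
  proof (intro conjI allI)
    show "0 < T' x" for x using Tpos pc by (simp add: T'_def)
    obtain B where "\<And>x. \<bar>f x\<bar> \<le> B" using v unfolding valid_def by auto
    then have "\<bar>f' x\<bar> \<le> B + c" for x
      unfolding f'_def using pc[of x] by (intro order_trans[OF abs_triangle_ineq] add_mono) auto
    then show "\<exists>B. \<forall>x. \<bar>f' x\<bar> \<le> B" by blast
    obtain F G where "\<And>x. (F has_real_derivative f x) (at x)" "\<And>x. (G has_real_derivative p x) (at x)"
      using v spike_has_antiderivative[OF d] unfolding valid_def p_def by meson
    then have "((\<lambda>x. F x + G x) has_real_derivative f' x) (at x)" for x
      unfolding f'_def by (rule DERIV_add)
    then show "\<exists>F. \<forall>x. (F has_real_derivative f' x) (at x)" by blast
    show "squeezed (-1) 1 f'"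
      using v squeezed_spike[OF c d] squeezed_add unfolding f'_def p_def valid_def by auto
  next
    fix x
    show "(isCont f' x \<and> (\<exists>\<eta>>0. \<forall>\<^sub>F y in nhds x. \<eta> \<le> T' y)) \<or> (\<forall>h. near f' T' h \<longrightarrow> oscillates h x)"
    proof (cases "x = s")
      case True
      have "oscillates h s" if h: "near f' T' h" for h
        unfolding oscillates_def
      proof (intro ballI allI impI)
        fix \<sigma> \<tau> e :: real assume *: "\<sigma> \<in> {-1, 1}" "\<tau> \<in> {-1, 1}" "0 < e"
        obtain y where y: "0 < \<tau> * (y - s)" "\<tau> * (y - s) < e" "\<sigma> * h y > \<sigma> * f s + c - c / 4"
          using overshoot[OF h *, of "c / 4"] c by auto
        \<comment> \<open>The spike is \<open>0\<close> at \<open>s\<close>, so \<open>h s\<close>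
          moves by at most \<open>c / 2\<close>, whereas the overshoot exceeds
          \<open>3 * c / 4\<close> in both directions and on both sides: the new discontinuity is
          settled.\<close>
        have "\<bar>h s - f s\<bar> \<le> c / 2"
          using h by (auto simp: near_def f'_def T'_def p_def dest: spec[of _ s])
        then have "h s \<le> f s + c / 2" "f s - c / 2 \<le> h s" by linarith+
        then have "\<sigma> * h s < \<sigma> * h y" using y(3) c *(1) by auto
        then show "\<exists>y. 0 < \<tau> * (y - s) \<and> \<tau> * (y - s) < e \<and> \<sigma> * h s < \<sigma> * h y"
          using y by blast
      qed
      then show ?thesis using True by blast
    next
      case False
      have pcont: "isCont p x" unfolding p_def by (rule isCont_spike[OF False d])
      consider "isCont f x" "\<exists>\<eta>>0. \<forall>\<^sub>F y in nhds x. \<eta> \<le> T y" | "\<forall>h. near f T h \<longrightarrow> oscillates h x"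
        using v unfolding valid_def by blast
      then show ?thesis
      proof cases
        case 1
        obtain \<eta>1 where \<eta>1: "0 < \<eta>1" "\<forall>\<^sub>F y in nhds x. \<eta>1 \<le> T y" using 1 by auto
        have "isCont (\<lambda>y. (c - \<bar>p y\<bar>) / 2) x" using pcont by (intro continuous_intros) auto
        then obtain \<eta>2 where \<eta>2: "0 < \<eta>2" "\<forall>\<^sub>F y in nhds x. \<eta>2 \<le> (c - \<bar>p y\<bar>) / 2"
          using eventually_ge_of_isCont[where x = x and g = "\<lambda>y. (c - \<bar>p y\<bar>) / 2"] pc[of x] by auto
        have "\<forall>\<^sub>F y in nhds x. min (\<eta>1 / 2) \<eta>2 \<le> T' y"
          using \<eta>1(2) \<eta>2(2) by eventually_elim (auto simp: T'_def)
        then have "\<exists>\<eta>>0. \<forall>\<^sub>F y in nhds x. \<eta> \<le> T' y"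
          using \<eta>1 \<eta>2 by (intro exI[of _ "min (\<eta>1 / 2) \<eta>2"]) auto
        moreover have "isCont f' x" unfolding f'_def using 1 pcont by (intro isCont_add)
        ultimately show ?thesis by blast
      qed (use near_refines[OF ref] in blast)
    qed
  qed
  moreover have "\<not> attains_max a b h" if h: "near f' T' h" for h
  proof
    assume "attains_max a b h"
    then obtain m where m: "m \<in> {a..b}" "\<And>y. y \<in> {a..b} \<Longrightarrow> h y \<le> h m"
      unfolding attains_max_def by auto
    have "\<bar>h m - (f m + p m)\<bar> \<le> (c - \<bar>p m\<bar>) / 2"
      using h by (auto simp: near_def f'_def T'_def dest: spec[of _ m])
    then have "h m - (f m + p m) \<le> (c - \<bar>p m\<bar>) / 2" by (rule abs_le_D1)
    then have less: "0 < f s + c - h m"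
      using s(2)[OF m(1)] pc[of m] abs_ge_self[of "p m"] by argo
    \<comment> \<open>The overshoot is applied with the positive gap \<open>f s + c - h m\<close> as
      \<open>\<delta>\<close>, to the right of \<open>s\<close> unless \<open>s = b\<close>.\<close>
    have "\<exists>y\<in>{a..b}. f s + c - (f s + c - h m) < h y"
    proof (cases "s < b")
      case True
      then show ?thesis using overshoot[OF h, of 1 1 "b - s", OF _ _ _ less] s(1) by force
    next
      case False
      then show ?thesis using overshoot[OF h, of 1 "-1" "s - a", OF _ _ _ less] s(1) ab by force
    qed
    then show False using m(2) by force
  qed
  ultimately show ?thesis using ref by blast
qed

text \<open>
  Here \<open>f\<close> itself is kept. The tolerance tends to 0 wherever \<open>f\<close> tends to its supremum on \<open>{a..b}\<close>, so
  this supremum remains a supremum that is not attained.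
\<close>

lemma refine_no_max:
  assumes v: "valid f T" and ab: "a < b" and nomax: "\<not> attains_max a b f"
  shows "\<exists>f' T'. valid f' T' \<and> refines f T f' T' \<and> (\<forall>h. near f' T' h \<longrightarrow> \<not> attains_max a b h)"
proof -
  have Tpos: "\<And>x. 0 < T x" using v by (simp add: valid_def)
  obtain B where B: "\<And>x. \<bar>f x\<bar> \<le> B" using v unfolding valid_def by auto
  define S where "S = Sup (f ` {a..b})"
  have bdd: "bdd_above (f ` {a..b})" using B by (intro bdd_aboveI[of _ B]) (auto simp: abs_le_iff)
  have ne: "f ` {a..b} \<noteq> {}" using ab by auto
  have le: "f x \<le> S" if "x \<in> {a..b}" for x
    unfolding S_def using that bdd by (intro cSup_upper) auto
  have less: "f x < S" if "x \<in> {a..b}" for x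
    using nomax le that unfolding attains_max_def by (metis order_less_le)
  define T' where "T' x = min (T x / 2) (if x \<in> {a..b} then (S - f x) / 2 else T x / 2)" for x
  have ref: "refines f T f T'"
    unfolding refines_def
  proof
    fix x show "\<bar>f x - f x\<bar> + T' x \<le> T x \<and> T' x \<le> T x / 2"
      using Tpos[of x] by (auto simp: T'_def)
  qed
  have "0 < T' x" for x using Tpos less by (simp add: T'_def)
  \<comment> \<open>At a point of continuity in \<open>{a..b}\<close> the positive function
    \<open>S - f\<close> stays away from \<open>0\<close> nearby. So \<open>T'\<close> can lose a
    positive lower bound only near points that are already settled.\<close>
  moreover have "(isCont f x \<and> (\<exists>\<eta>>0. \<forall>\<^sub>F y in nhds x. \<eta> \<le> T' y)) \<or> (\<forall>h. near f T' h \<longrightarrow> oscillates h x)" for x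
  proof -
    consider "isCont f x" "\<exists>\<eta>>0. \<forall>\<^sub>F y in nhds x. \<eta> \<le> T y" | "\<forall>h. near f T h \<longrightarrow> oscillates h x"
      using v unfolding valid_def by blast
    then show ?thesis
    proof cases
      case 1
      obtain \<eta>1 where \<eta>1: "0 < \<eta>1" "\<forall>\<^sub>F y in nhds x. \<eta>1 \<le> T y" using 1 by auto
      have "\<exists>\<eta>>0. \<forall>\<^sub>F y in nhds x. \<eta> \<le> T' y"
      proof (cases "x \<in> {a..b}")
        case True
        have "isCont (\<lambda>y. (S - f y) / 2) x" using 1 by (intro continuous_intros) auto
        then obtain \<eta>2 where \<eta>2: "0 < \<eta>2" "\<forall>\<^sub>F y in nhds x. \<eta>2 \<le> (S - f y) / 2"
          using eventually_ge_of_isCont[where x = x and g = "\<lambda>y. (S - f y) / 2"] less[OF True] by auto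
        have "\<forall>\<^sub>F y in nhds x. min (\<eta>1 / 2) \<eta>2 \<le> T' y"
          using \<eta>1(2) \<eta>2(2) by eventually_elim (auto simp: T'_def)
        then show ?thesis using \<eta>1 \<eta>2 by (intro exI[of _ "min (\<eta>1 / 2) \<eta>2"]) auto
      next
        case False
        then have "\<forall>\<^sub>F y in nhds x. y \<in> - {a..b}"
          by (intro eventually_nhds_in_open) auto
        then have "\<forall>\<^sub>F y in nhds x. \<eta>1 / 2 \<le> T' y"
          using \<eta>1(2) by eventually_elim (auto simp: T'_def)
        then show ?thesis using \<eta>1 by (intro exI[of _ "\<eta>1 / 2"]) auto
      qed
      then show ?thesis using 1 by blast
    qed (use near_refines[OF ref] in blast)
  qed
  ultimately have "valid f T'" using v unfolding valid_def by blast
  moreover have "\<not> attains_max a b h" if h: "near f T' h" for h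
  proof
    assume "attains_max a b h"
    then obtain m where m: "m \<in> {a..b}" "\<And>y. y \<in> {a..b} \<Longrightarrow> h y \<le> h m"
      unfolding attains_max_def by auto
    have hb: "h x - f x \<le> (S - f x) / 2" "f x - h x \<le> (S - f x) / 2" if "x \<in> {a..b}" for x
    proof -
      have "\<bar>h x - f x\<bar> \<le> (S - f x) / 2"
        using h that by (auto simp: near_def T'_def dest: spec[of _ x])
      from abs_le_D1[OF this] abs_le_D2[OF this]
      show "h x - f x \<le> (S - f x) / 2" "f x - h x \<le> (S - f x) / 2" by simp_all
    qed
    \<comment> \<open>The solution of \<open>(3 * q - S) / 2 = h m\<close>: since
      \<open>h y \<ge> (3 * f y - S) / 2\<close>, any \<open>f y\<close> above \<open>q\<close>
      forces \<open>h y > h m\<close>.\<close>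
    define q where "q = (2 * h m + S) / 3"
    have hm: "h m < S" using hb(1)[OF m(1)] less[OF m(1)] by argo
    then have "q < Sup (f ` {a..b})" by (simp add: q_def S_def[symmetric])
    then obtain y where y: "y \<in> {a..b}" "q < f y" using less_cSup_iff[OF ne bdd] by auto
    then have "h m < h y" using hb(2)[OF y(1)] hm unfolding q_def by argo
    then show False using m(2)[OF y(1)] by simp
  qed
  ultimately show ?thesis using ref by blast
qed

lemma refine_max:
  assumes "valid f T" "a < b"
  shows "\<exists>f' T'. valid f' T' \<and> refines f T f' T' \<and> (\<forall>h. near f' T' h \<longrightarrow> \<not> attains_max a b h)"
proof (cases "attains_max a b f")
  case True
  then obtain s where "s \<in> {a..b}" "\<And>y. y \<in> {a..b} \<Longrightarrow> f y \<le> f s"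
    unfolding attains_max_def by auto
  then show ?thesis by (rule refine_at_max[OF assms])
qed (rule refine_no_max[OF assms])

text \<open>The maximum is removed first, then the minimum by refining the negated function. Nesting
  of the tubes preserves the first achievement.\<close>

lemma refine_max_min:
  assumes v: "valid f T" and ab: "a < b"
  shows "\<exists>f' T'. valid f' T' \<and> refines f T f' T' \<and>
    (\<forall>h. near f' T' h \<longrightarrow> \<not> attains_max a b h \<and> \<not> attains_max a b (\<lambda>x. - h x))"
proof -
  obtain f1 T1 where 1: "valid f1 T1" "refines f T f1 T1" "\<And>h. near f1 T1 h \<Longrightarrow> \<not> attains_max a b h"
    using refine_max[OF v ab] by blast
  obtain f2 T2 where 2: "valid f2 T2" "refines (\<lambda>x. - f1 x) T1 f2 T2" "\<And>h. near f2 T2 h \<Longrightarrow> \<not> attains_max a b h"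
    using refine_max[OF valid_uminus[OF 1(1)] ab] by blast
  define f' where "f' x = - f2 x" for x
  have "valid f' T2" unfolding f'_def by (rule valid_uminus[OF 2(1)])
  moreover have ref: "refines f1 T1 f' T2"
    using 2(2) unfolding refines_def f'_def
    by (simp add: abs_minus_commute add.commute)
  moreover have "refines f T f' T2"
    using refines_trans[OF 1(2) ref] v by (simp add: valid_def)
  moreover have "\<not> attains_max a b h" "\<not> attains_max a b (\<lambda>x. - h x)" if "near f' T2 h" for h
    using that 1(3) 2(3) near_refines[OF ref] near_uminus[of f2 T2 h] unfolding f'_def by auto
  ultimately show ?thesis by blast
qed

section \<open>The limit of the refinements\<close>

lemma valid_0: "valid (\<lambda>x. 0) (\<lambda>x. 1)"
proof -
  have "((\<lambda>x. 0) has_real_derivative 0) (at x)" for x :: real by simp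
  then show ?thesis unfolding valid_def using squeezed_0
    by (auto intro!: exI[of _ "1::real"] exI[of _ "\<lambda>x. 0 :: real"])
qed

text \<open>Dependent choice runs through an enumeration of all pairs of rationals. The limit lies
  in every tube and so inherits what each step has settled.\<close>

lemma no_interval_extrema:
  "\<exists>F f :: real \<Rightarrow> real. (\<forall>x. (F has_real_derivative f x) (at x)) \<and> squeezed (-1) 1 f \<and>
     (\<forall>p q :: rat. p < q \<longrightarrow> \<not> attains_max (of_rat p) (of_rat q) f \<and>
        \<not> attains_max (of_rat p) (of_rat q) (\<lambda>x. - f x))"
proof -
  define settles :: "rat \<times> rat \<Rightarrow> (real \<Rightarrow> real) \<times> (real \<Rightarrow> real) \<Rightarrow> bool" where
    "settles I w \<longleftrightarrow> (\<forall>h. near (fst w) (snd w) h \<longrightarrow> fst I < snd I \<longrightarrow>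
       \<not> attains_max (of_rat (fst I)) (of_rat (snd I)) h \<and>
       \<not> attains_max (of_rat (fst I)) (of_rat (snd I)) (\<lambda>x. - h x))" for I w
  have step: "\<exists>w. (valid (fst w) (snd w)) \<and> (refines (fst z) (snd z) (fst w) (snd w) \<and> settles I w)"
    if "valid (fst z) (snd z)" for z I
  proof (cases "fst I < snd I")
    case True
    then have "of_rat (fst I) < (of_rat (snd I) :: real)" by (simp add: of_rat_less)
    from refine_max_min[OF that this] obtain f' T' where
      "valid f' T'" "refines (fst z) (snd z) f' T'"
      "\<And>h. near f' T' h \<Longrightarrow> \<not> attains_max (of_rat (fst I)) (of_rat (snd I)) h \<and>
         \<not> attains_max (of_rat (fst I)) (of_rat (snd I)) (\<lambda>x. - h x)"
      by blast
    then show ?thesis unfolding settles_def by (intro exI[of _ "(f', T')"]) simp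
  next
    case False
    \<comment> \<open>A pair that is not increasing needs nothing settled, but a refinement, here on
      \<open>{0..1}\<close>, is still made to halve the tolerance.\<close>
    from refine_max_min[OF that zero_less_one] obtain f' T' where
      "valid f' T'" "refines (fst z) (snd z) f' T'"
      by blast
    with False show ?thesis unfolding settles_def by (intro exI[of _ "(f', T')"]) simp
  qed
  have "\<exists>w. \<forall>n. (valid (fst (w n)) (snd (w n)) \<and> (n = 0 \<longrightarrow> w n = (\<lambda>x. 0, \<lambda>x. 1))) \<and>
      (refines (fst (w n)) (snd (w n)) (fst (w (Suc n))) (snd (w (Suc n))) \<and> settles (from_nat n) (w (Suc n)))"
    by (rule dependent_nat_choice) (use step valid_0 in auto)
  then obtain w where w: "\<And>n. valid (fst (w n)) (snd (w n))" "w 0 = (\<lambda>x. 0, \<lambda>x. 1)"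
    "\<And>n. refines (fst (w n)) (snd (w n)) (fst (w (Suc n))) (snd (w (Suc n)))"
    "\<And>n. settles (from_nat n) (w (Suc n))"
    by blast
  define f where "f n = fst (w n)" for n
  define T where "T n = snd (w n)" for n
  have Tpos: "0 < T n x" for n x using w(1)[of n] by (simp add: T_def valid_def)
  have ref: "\<bar>f (Suc n) x - f n x\<bar> + T (Suc n) x \<le> T n x" "T (Suc n) x \<le> T n x / 2" for n x
    using w(3)[of n] by (auto simp: refines_def f_def T_def)
  \<comment> \<open>The bound does not depend on \<open>x\<close>, since the initial tolerance is
    constantly \<open>1\<close>; this makes the convergence uniform.\<close>
  have small: "T n x \<le> (1 / 2) ^ n" for n x
  proof (induction n)
    case (Suc n)
    then show ?case using ref(2)[of n x] by simp
  qed (simp add: T_def w(2))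
  have lower: "f n x - T n x \<le> f m x - T m x" if "n \<le> m" for n m x
    using that
  proof (induction m rule: dec_induct)
    case (step m) then show ?case using ref(1)[where n = m and x = x] by linarith
  qed simp
  have upper: "f m x + T m x \<le> f n x + T n x" if "n \<le> m" for n m x
    using that
  proof (induction m rule: dec_induct)
    case (step m) then show ?case using ref(1)[where n = m and x = x] by linarith
  qed simp
  have cross: "f n x - T n x \<le> f m x + T m x" for n m x
    using lower[of n "max n m" x] upper[of m "max n m" x] Tpos[of "max n m" x] by simp
  \<comment> \<open>By \<open>cross\<close>, every lower end of a tube lies below every upper end,
    so the supremum of the lower ends lies in all tubes.\<close>
  define h where "h x = (SUP n. f n x - T n x)" for x
  have "bdd_above (range (\<lambda>n. f n x - T n x))" for x
    using cross[where m = 0] by (intro bdd_aboveI[of _ "f 0 x + T 0 x"]) auto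
  then have "f n x - T n x \<le> h x" "h x \<le> f n x + T n x" for n x
    unfolding h_def using cross by (auto intro: cSUP_upper cSUP_least)
  then have near: "near (f n) (T n) h" for n
    unfolding near_def abs_le_iff by (simp add: algebra_simps)
  have close: "\<exists>n. \<forall>x. \<bar>h x - f n x\<bar> \<le> e" if e: "0 < e" for e :: real
  proof -
    obtain n where "(1 / 2) ^ n < e" using real_arch_pow_inv[OF e, of "1 / 2"] by auto
    then show ?thesis using near[of n] small[of n] unfolding near_def by (meson less_imp_le order_trans)
  qed
  have "\<exists>H. \<forall>x\<in>UNIV. (H has_derivative (*) (h x)) (at x within UNIV)"
  proof (rule has_antiderivative_limit[OF convex_UNIV])
    fix e :: real assume "0 < e"
    then obtain n where n: "\<And>x. \<bar>h x - f n x\<bar> \<le> e" using close by blast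
    obtain F where F: "\<And>x. (F has_real_derivative f n x) (at x)"
      using w(1)[of n] unfolding valid_def f_def by auto
    have "norm (f n x * k - h x * k) \<le> e * norm k" for x k
    proof -
      have "\<bar>f n x * k - h x * k\<bar> = \<bar>h x - f n x\<bar> * \<bar>k\<bar>"
        by (simp add: left_diff_distrib[symmetric] abs_mult abs_minus_commute)
      then show ?thesis using n by (simp add: mult_right_mono)
    qed
    then show "\<exists>F F'. \<forall>x\<in>UNIV. (F has_derivative F' x) (at x within UNIV) \<and>
        (\<forall>k. norm (F' x k - h x * k) \<le> e * norm k)"
      using F unfolding has_field_derivative_def
      by (intro exI[of _ F] exI[of _ "\<lambda>x. (*) (f n x)"]) auto
  qed
  then obtain H where H: "\<And>x. (H has_real_derivative h x) (at x)"
    unfolding has_field_derivative_def by auto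
  have sq: "squeezed (-1) 1 h"
  proof (rule squeezed_uniform_approx)
    fix e :: real assume "0 < e"
    then obtain n where "\<And>x. \<bar>h x - f n x\<bar> \<le> e" using close by blast
    then show "\<exists>g. squeezed (-1) 1 g \<and> (\<forall>x\<in>{-1..1}. \<bar>h x - g x\<bar> \<le> e)"
      using w(1)[of n] unfolding valid_def f_def by blast
  qed
  have "\<not> attains_max (of_rat p) (of_rat q) h \<and> \<not> attains_max (of_rat p) (of_rat q) (\<lambda>x. - h x)"
    if "p < q" for p q :: rat
    using w(4)[of "to_nat (p, q)"] near[of "Suc (to_nat (p, q))"] that
    unfolding settles_def f_def T_def by simp
  with H sq show ?thesis by (intro exI[of _ H] exI[of _ h]) auto
qed

section \<open>From rational intervals to the theorem\<close>

lemma rational_interval_around: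
  fixes x e :: real
  assumes x: "x \<in> {-1..1}" and e: "0 < e"
  shows "\<exists>p q :: rat. p < q \<and> x \<in> {of_rat p..of_rat q} \<and>
    {of_rat p..of_rat q} \<subseteq> {x - e<..<x + e} \<inter> {-1..1}"
proof -
  \<comment> \<open>At the endpoints of the domain, \<open>-1\<close> and \<open>1\<close>
    themselves are the rational ends; this is how one-sided extrema become extrema on a rational
    interval.\<close>
  have "\<exists>p::rat. -1 \<le> (of_rat p::real) \<and> of_rat p \<le> x \<and> x - e < of_rat p \<and> (x \<noteq> -1 \<longrightarrow> of_rat p < x)"
  proof (cases "x = -1")
    case False
    then have "max (-1) (x - e) < x" using x e by auto
    then show ?thesis using of_rat_dense[of "max (-1) (x - e)" x] by (auto intro: less_imp_le)
  qed (use e in \<open>auto intro!: exI[of _ "-1"]\<close>)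
  then obtain p :: rat where p: "-1 \<le> (of_rat p::real)" "of_rat p \<le> x" "x - e < of_rat p"
    "x \<noteq> -1 \<Longrightarrow> of_rat p < x" by blast
  have "\<exists>q::rat. (of_rat q::real) \<le> 1 \<and> x \<le> of_rat q \<and> of_rat q < x + e \<and> (x \<noteq> 1 \<longrightarrow> x < of_rat q)"
  proof (cases "x = 1")
    case False
    then have "x < min 1 (x + e)" using x e by auto
    then show ?thesis using of_rat_dense[of x "min 1 (x + e)"] by (auto intro: less_imp_le)
  qed (use e in \<open>auto intro!: exI[of _ "1"]\<close>)
  then obtain q :: rat where q: "(of_rat q::real) \<le> 1" "x \<le> of_rat q" "of_rat q < x + e"
    "x \<noteq> 1 \<Longrightarrow> x < of_rat q" by blast
  have "(of_rat p :: real) < of_rat q"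
    by (cases "x = 1") (use p q in auto)
  then have "p < q" by (simp add: of_rat_less)
  then show ?thesis using p q by (intro exI[of _ p] exI[of _ q]) auto
qed

theorem mainTheorem1:
  shows "\<exists>f :: real \<Rightarrow> real.
           riemann_integrable f (-1) 1 \<and>
           has_antiderivative_on f {-1..1} \<and>
           (\<forall>x0\<in>{-1..1}. \<not> local_max_on {-1..1} f x0 \<and> \<not> local_min_on {-1..1} f x0) \<and>
           (\<forall>a b. a < b \<and> {a<..<b} \<subseteq> {-1..1} \<longrightarrow>
              \<not> (mono_on {a<..<b} f \<or> antimono_on {a<..<b} f))"
proof -
  obtain F f where F: "\<And>x. (F has_real_derivative f x) (at x)" and sq: "squeezed (-1) 1 f"
    and nomax: "\<And>p q :: rat. p < q \<Longrightarrow> \<not> attains_max (of_rat p) (of_rat q) f"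
    and nomin: "\<And>p q :: rat. p < q \<Longrightarrow> \<not> attains_max (of_rat p) (of_rat q) (\<lambda>x. - f x)"
    using no_interval_extrema by metis
  have "(f has_integral (F 1 - F (-1))) {-1..1}"
    using F by (intro fundamental_theorem_of_calculus)
      (auto simp: has_real_derivative_iff_has_vector_derivative[symmetric] intro: has_field_derivative_at_within)
  then have R: "riemann_integrable f (-1) 1"
    using sq squeezed_imp_riemann_integrable by blast
  have A: "has_antiderivative_on f {-1..1}"
    unfolding has_antiderivative_on_def using F has_field_derivative_at_within by blast
  have E: "\<not> local_max_on {-1..1} f x \<and> \<not> local_min_on {-1..1} f x" if x: "x \<in> {-1..1}" for x
  proof (intro conjI notI)
    assume "local_max_on {-1..1} f x"
    then obtain e where e: "0 < e" "\<And>y. y \<in> {x - e<..<x + e} \<inter> {-1..1} \<Longrightarrow> f y \<le> f x"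
      unfolding local_max_on_def by blast
    obtain p q :: rat where pq: "p < q" "x \<in> {of_rat p..of_rat q}"
      "{of_rat p..of_rat q} \<subseteq> {x - e<..<x + e} \<inter> {-1..1}"
      using rational_interval_around[OF x e(1)] by blast
    have "attains_max (of_rat p) (of_rat q) f"
      unfolding attains_max_def using pq(2) e(2) subsetD[OF pq(3)] by (intro bexI[of _ x]) auto
    then show False using nomax[OF pq(1)] by blast
  next
    assume "local_min_on {-1..1} f x"
    then obtain e where e: "0 < e" "\<And>y. y \<in> {x - e<..<x + e} \<inter> {-1..1} \<Longrightarrow> - f y \<le> - f x"
      unfolding local_min_on_def by (auto simp: Ball_def)
    obtain p q :: rat where pq: "p < q" "x \<in> {of_rat p..of_rat q}"
      "{of_rat p..of_rat q} \<subseteq> {x - e<..<x + e} \<inter> {-1..1}"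
      using rational_interval_around[OF x e(1)] by blast
    have "attains_max (of_rat p) (of_rat q) (\<lambda>x. - f x)"
      unfolding attains_max_def using pq(2) e(2) subsetD[OF pq(3)] by (intro bexI[of _ x]) auto
    then show False using nomin[OF pq(1)] by blast
  qed
  \<comment> \<open>A monotone function attains its maximum on a rational subinterval at one of the
    ends: the right one if it is non-decreasing, the left one if non-increasing.\<close>
  have "\<not> (mono_on {a<..<b} f \<or> antimono_on {a<..<b} f)" if ab: "a < b" for a b
  proof -
    obtain p :: rat where p: "a < of_rat p" "of_rat p < b" using of_rat_dense[OF ab] by blast
    obtain q :: rat where q: "of_rat p < (of_rat q :: real)" "of_rat q < b"
      using of_rat_dense[OF p(2)] by blast
    have pq: "p < q" using q by (simp add: of_rat_less)
    show ?thesis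
    proof
      assume "mono_on {a<..<b} f \<or> antimono_on {a<..<b} f"
      then show False
      proof
        assume "mono_on {a<..<b} f"
        then have "attains_max (of_rat p) (of_rat q) f"
          unfolding attains_max_def using p q
          by (intro bexI[of _ "of_rat q"]) (auto intro: monotone_onD)
        then show False using nomax[OF pq] by blast
      next
        assume "antimono_on {a<..<b} f"
        then have "attains_max (of_rat p) (of_rat q) f"
          unfolding attains_max_def using p q
          by (intro bexI[of _ "of_rat p"]) (auto simp: monotone_on_def)
        then show False using nomax[OF pq] by blast
      qed
    qed
  qed
  with R A E show ?thesis by blast
qed

end
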